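(* Let $\psi$ be the $\mathbb{Z}$-linear map from the free $\mathbb{Z}$-module $M^f$ generated by framed chord diagrams to the free $\mathbb{Z}$-module $M_2$ generated by double chord diagrams, defined on generators as follows. Let $D$ be a framed chord diagram with core circle $C$ and $n$ chords. Take two copies $C_1, C_2$ of $C$. For each chord $d$ of $D$ with endpoints $u,v\in C$, choose one of two positions: if $d$ has framing $0$, either the chord joining the copies of $u$ and $v$ on $C_1$, or the chord joining the copies of $u$ and $v$ on $C_2$; if $d$ has framing $1$, either the chord joining the copy of $u$ on $C_1$ to the copy of $v$ on $C_2$, or the chord joining the copy of $v$ on $C_1$ to the copy of $u$ on $C_2$. Each of the $2^n$ families of choices gives a double chord diagram with core circles $C_1$ (with the orientation of $C$) and $C_2$ (with the orientation opposite to that of $C$), and $\psi(D)$ is the sum of these $2^n$ double chord diagrams. Then $\psi$ induces a well-defined map of quotient modules $\psi\colon\mathcal{M}^f\to\mathcal{M}_2$, where $\mathcal{M}^f$ and $\mathcal{M}_2$ are the quotients of $M^f$ and $M_2$ by the respective $4$T-relations.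
   Context: A chord diagram is a finite cubic graph consisting of a distinguished oriented Hamiltonian cycle (the core circle) and finitely many non-oriented edges (chords) joining points of the core circle, so that every point of the core circle is incident to at most one chord; the oriented circle with no chords is also allowed. It is framed if every chord is assigned a framing in $\mathbb{Z}/2\mathbb{Z}=\{0,1\}$. Framed chord diagrams are considered up to isomorphisms preserving the core circle, its orientation and the framing. $M^f$ is the free $\mathbb{Z}$-module generated by (isomorphism classes of) framed chord diagrams. A double chord diagram consists of two disjoint oriented circles (the core circles) and finitely many non-oriented chords (without framing) joining points of the core circles (both endpoints of a chord may be on the same circle or on different circles), so that every point of a core circle is incident to at most one chord. Double chord diagrams are considered up to isomorphisms preserving the core circles with their orientations (the two core circles may be interchanged). $M_2$ is the free $\mathbb{Z}$-module generated by (isomorphism classes of) double chord diagrams. $4$T-relations. Fix a diagram together with a chord $b$ with endpoints $p,q$ and a further marked point $y$ on a core circle, distinct from all chord endpoints. For a point $r\in\{p,q\}$, let $r^-$ (resp. $r^+$) denote a point lying immediately before (resp. immediately after) $r$ with respect to the orientation of the core circle containing $r$, so that no chord endpoint and not the point $y$ lies strictly between it and $r$. For a point $x$ among $p^-,p^+,q^-,q^+$, add to the diagram a chord $a$ joining $y$ to $x$; everything else in the diagram is unchanged. (i) Double chord diagrams: let $D(x)$ be the double chord diagram so obtained. The $4$T-relation is $D(p^-)-D(p^+)=D(q^+)-D(q^-)$. Here $p$, $q$, $y$ may lie on either of the two core circles in any way. (ii) Framed chord diagrams: let $D_\varepsilon(x)$ be the framed chord diagram so obtained when $a$ has framing $\varepsilon\in\{0,1\}$.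 If $b$ has framing $0$, the relation is $D_\varepsilon(p^-)-D_\varepsilon(p^+)=D_\varepsilon(q^+)-D_\varepsilon(q^-)$ for each $\varepsilon$. If $b$ has framing $1$, the relation is $D_\varepsilon(p^-)-D_\varepsilon(p^+)=D_{1-\varepsilon}(q^-)-D_{1-\varepsilon}(q^+)$ for each $\varepsilon$. $\mathcal{M}^f$ is the quotient of $M^f$ by the submodule generated by all relations (ii), and $\mathcal{M}_2$ is the quotient of $M_2$ by the submodule generated by all relations (i). *)

theory Defs
  imports
    "HOL-Algebra.Free_Abelian_Groups"
    "HOL-Algebra.Coset"
    "HOL-Algebra.Generated_Groups"
    "HOL-Library.Disjoint_Sets"
    "HOL-Library.Z2"
begin

text \<open>
  An oriented core circle is given by the list of its marked points, read once around along the
  orientation from an arbitrary starting point; isomorphisms may rotate the list, and the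
  empty list is the circle without marked points.  In a chord diagram the marked points are
  exactly the chord endpoints, and a chord is the two-element set of its endpoints.  As any
  infinite type of points yields the same isomorphism classes, all points are natural numbers.
\<close>

definition chords_on :: "nat set \<Rightarrow> nat set set \<Rightarrow> bool" where
  "chords_on V K \<longleftrightarrow> partition_on V K \<and> (\<forall>d\<in>K. card d = 2)"


subsection \<open>Framed chord diagrams\<close>

text \<open>Only the values of the framing on the chords are relevant.\<close>

record framed_cd =
  core :: "nat list"
  chords :: "nat set set"
  framing :: "nat set \<Rightarrow> bit"

definition framed_cds :: "framed_cd set" where
  "framed_cds = {D. distinct (core D) \<and> chords_on (set (core D)) (chords D)}"

definition framed_iso :: "framed_cd rel" where
  "framed_iso = {(D, E). D \<in> framed_cds \<and> E \<in> framed_cds \<and>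
     (\<exists>f k. inj_on f (set (core D)) \<and>
            core E = rotate k (map f (core D)) \<and>
            chords E = (`) f ` chords D \<and>
            (\<forall>d\<in>chords D. framing E (f ` d) = framing D d))}"

definition framed_class :: "framed_cd \<Rightarrow> framed_cd set" where
  "framed_class D = framed_iso `` {D}"

definition Mf :: "(framed_cd set \<Rightarrow>\<^sub>0 int) monoid" where
  "Mf = free_Abelian_group (framed_cds // framed_iso)"


subsection \<open>Double chord diagrams\<close>

record double_cd =
  core1 :: "nat list"
  core2 :: "nat list"
  dchords :: "nat set set"

definition double_cds :: "double_cd set" where
  "double_cds = {D. distinct (core1 D @ core2 D) \<and>
     chords_on (set (core1 D @ core2 D)) (dchords D)}"

definition double_iso :: "double_cd rel" where
  "double_iso = {(D, E). D \<in> double_cds \<and> E \<in> double_cds \<and>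
     (\<exists>f k l. inj_on f (set (core1 D @ core2 D)) \<and>
        (core1 E = rotate k (map f (core1 D)) \<and> core2 E = rotate l (map f (core2 D)) \<or>
         core1 E = rotate k (map f (core2 D)) \<and> core2 E = rotate l (map f (core1 D))) \<and>
        dchords E = (`) f ` dchords D)}"

definition double_class :: "double_cd \<Rightarrow> double_cd set" where
  "double_class D = double_iso `` {D}"

definition M2 :: "(double_cd set \<Rightarrow>\<^sub>0 int) monoid" where
  "M2 = free_Abelian_group (double_cds // double_iso)"


subsection \<open>4T-relations\<close>

text \<open>
  Insertion of a new point \<open>x\<close> immediately before or after the point \<open>r\<close>;
  a circle not containing \<open>r\<close> is left unchanged.
\<close>

definition ins_before :: "nat \<Rightarrow> nat \<Rightarrow> nat list \<Rightarrow> nat list" where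
  "ins_before x r c = concat (map (\<lambda>z. if z = r then [x, z] else [z]) c)"

definition ins_after :: "nat \<Rightarrow> nat \<Rightarrow> nat list \<Rightarrow> nat list" where
  "ins_after x r c = concat (map (\<lambda>z. if z = r then [z, x] else [z]) c)"

text \<open>
  The diagram from which the four terms of a relation are built has, besides its chord
  endpoints, the marked point \<open>y\<close> on a core circle; \<open>x\<close> is a name for the
  second endpoint of the chord to be added.
\<close>

definition framed_4T_data :: "framed_cd \<Rightarrow> nat \<Rightarrow> nat \<Rightarrow> nat \<Rightarrow> nat \<Rightarrow> bool" where
  "framed_4T_data B p q y x \<longleftrightarrow>
     distinct (core B) \<and> y \<in> set (core B) \<and>
     chords_on (set (core B) - {y}) (chords B) \<and>
     {p, q} \<in> chords B \<and> x \<notin> set (core B)"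

definition framed_add :: "framed_cd \<Rightarrow> nat \<Rightarrow> nat \<Rightarrow> bit \<Rightarrow> (nat list \<Rightarrow> nat list) \<Rightarrow> framed_cd" where
  "framed_add B y x \<epsilon> ins =
     \<lparr>core = ins (core B),
      chords = insert {y, x} (chords B),
      framing = (framing B)({y, x} := \<epsilon>)\<rparr>"

definition rel_4T_framed :: "(framed_cd set \<Rightarrow>\<^sub>0 int) set" where
  "rel_4T_framed =
     (let D = (\<lambda>B y x \<epsilon> ins. frag_of (framed_class (framed_add B y x \<epsilon> ins))) in
      {(D B y x \<epsilon> (ins_before x p) - D B y x \<epsilon> (ins_after x p))
         - (D B y x \<epsilon> (ins_after x q) - D B y x \<epsilon> (ins_before x q)) | B p q y x \<epsilon>.
         framed_4T_data B p q y x \<and> framing B {p, q} = 0} \<union>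
      {(D B y x \<epsilon> (ins_before x p) - D B y x \<epsilon> (ins_after x p))
         - (D B y x (1 - \<epsilon>) (ins_before x q) - D B y x (1 - \<epsilon>) (ins_after x q)) | B p q y x \<epsilon>.
         framed_4T_data B p q y x \<and> framing B {p, q} = 1})"

definition double_4T_data :: "double_cd \<Rightarrow> nat \<Rightarrow> nat \<Rightarrow> nat \<Rightarrow> nat \<Rightarrow> bool" where
  "double_4T_data B p q y x \<longleftrightarrow>
     distinct (core1 B @ core2 B) \<and> y \<in> set (core1 B @ core2 B) \<and>
     chords_on (set (core1 B @ core2 B) - {y}) (dchords B) \<and>
     {p, q} \<in> dchords B \<and> x \<notin> set (core1 B @ core2 B)"

definition double_add :: "double_cd \<Rightarrow> nat \<Rightarrow> nat \<Rightarrow> (nat list \<Rightarrow> nat list) \<Rightarrow> double_cd" where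
  "double_add B y x ins =
     \<lparr>core1 = ins (core1 B),
      core2 = ins (core2 B),
      dchords = insert {y, x} (dchords B)\<rparr>"

definition rel_4T_double :: "(double_cd set \<Rightarrow>\<^sub>0 int) set" where
  "rel_4T_double =
     (let D = (\<lambda>B y x ins. frag_of (double_class (double_add B y x ins))) in
      {(D B y x (ins_before x p) - D B y x (ins_after x p))
         - (D B y x (ins_after x q) - D B y x (ins_before x q)) | B p q y x.
         double_4T_data B p q y x})"

text \<open>Submodules of a \<open>\<int>\<close>-module are subgroups of its additive group.\<close>

definition Nf :: "(framed_cd set \<Rightarrow>\<^sub>0 int) set" where
  "Nf = generate Mf rel_4T_framed"

definition N2 :: "(double_cd set \<Rightarrow>\<^sub>0 int) set" where
  "N2 = generate M2 rel_4T_double"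


subsection \<open>The map \<open>\<psi>\<close>\<close>

text \<open>The two copies of a point of \<open>C\<close>, on \<open>C\<^sub>1\<close> and on \<open>C\<^sub>2\<close>.\<close>

definition copy1 :: "nat \<Rightarrow> nat" where "copy1 v = 2 * v"
definition copy2 :: "nat \<Rightarrow> nat" where "copy2 v = 2 * v + 1"

text \<open>
  The two positions of a chord.  For framing 1, \<open>u\<close> and \<open>v\<close> range over both
  orderings of the two endpoints.
\<close>

definition positions :: "framed_cd \<Rightarrow> nat set \<Rightarrow> nat set set" where
  "positions D d =
     (if framing D d = 0 then {copy1 ` d, copy2 ` d}
      else {{copy1 u, copy2 v} | u v. d = {u, v}})"

text \<open>
  For a family \<open>\<sigma>\<close> of positions, only those points of the two copies of the circle
  that are endpoints of a chosen chord remain marked.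
\<close>

definition double_of :: "framed_cd \<Rightarrow> (nat set \<Rightarrow> nat set) \<Rightarrow> double_cd" where
  "double_of D \<sigma> =
     (let K = \<sigma> ` chords D in
      \<lparr>core1 = filter (\<lambda>v. v \<in> \<Union>K) (map copy1 (core D)),
       core2 = filter (\<lambda>v. v \<in> \<Union>K) (map copy2 (rev (core D))),
       dchords = K\<rparr>)"

definition psi_diagram :: "framed_cd \<Rightarrow> double_cd set \<Rightarrow>\<^sub>0 int" where
  "psi_diagram D =
     (\<Sum>\<sigma> \<in> PiE (chords D) (positions D). frag_of (double_class (double_of D \<sigma>)))"

text \<open>
  On a generator, \<open>\<psi>\<close> is computed from an arbitrary representative; independence of
  the choice is not built into the definition.
\<close>

definition psi :: "(framed_cd set \<Rightarrow>\<^sub>0 int) \<Rightarrow> (double_cd set \<Rightarrow>\<^sub>0 int)" where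
  "psi = frag_extend (\<lambda>X. psi_diagram (SOME D. D \<in> X))"

end

theory Submission
  imports Defs
begin

text \<open>
  All the content is in two facts about the circle \<open>C\<close> and its copies \<open>C\<^sub>1\<close>, \<open>C\<^sub>2\<close>.

  First, \<open>\<psi>\<close> does not depend on the representative: an isomorphism of framed diagrams
  acts on the copies of the points and on the positions of the chords, so it matches the families
  of choices bijectively, and matching families give isomorphic double diagrams
  (\<open>psi_diagram_iso\<close>).

  Second, \<open>\<psi>\<close> maps each 4T-relation to a sum of 4T-relations and zeros.  In such a relation
  a chord \<open>a\<close> from \<open>y\<close> to a point \<open>x\<close> next to an endpoint of \<open>b = {p, q}\<close> is added to a
  diagram \<open>B\<close>.  Fix a position for every chord of \<open>B\<close>, including \<open>b\<close>, and fix the copy of \<open>y\<close>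
  used by \<open>a\<close>; the framing of \<open>a\<close> then decides on which circle \<open>C\<^sub>k\<close> the copy of \<open>x\<close> lies.
  If the endpoint of \<open>b\<close> over \<open>p\<close> is not on \<open>C\<^sub>k\<close>, then nothing is marked on \<open>C\<^sub>k\<close> between the
  places before and after \<open>p\<close>, so the two terms at \<open>p\<close> cancel, and the same happens at \<open>q\<close>.  If it
  is on \<open>C\<^sub>k\<close>, the four terms form a 4T-relation of double diagrams, up to sign: \<open>C\<^sub>2\<close> is
  reversed, so ``before'' and ``after'' are exchanged there.  When \<open>b\<close> has framing 1, its two
  endpoints lie on different circles, which is why the framed relation exchanges ``before'' and
  ``after'' at \<open>q\<close> and changes the framing of \<open>a\<close>.

  Everything becomes uniform in the framings when the two circles, the two sides of a point and
  the framings are all indexed by \<open>\<int>/2\<close>, with \<open>C\<^sub>1\<close> and \<open>C\<^sub>2\<close> as circles 0 and 1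
  and before and after as sides 0 and 1: a chord of framing \<open>\<phi>\<close> starting on circle \<open>i\<close>
  ends on circle \<open>i + \<phi>\<close>, and side \<open>s\<close> of a point on \<open>C\<close> becomes side \<open>s + k\<close> on circle \<open>k\<close>.
  The cancellation is \<open>double_on_ins_unmarked\<close>, the transfer of an insertion to the double diagram
  is \<open>double_on_ins_marked\<close>, and the two cases are put together in
  \<open>framed_4T_family_in_N2\<close>.
\<close>

section \<open>Cyclic words\<close>

definition cyclic_shift :: "'a list \<Rightarrow> 'a list \<Rightarrow> bool" where
  "cyclic_shift xs ys \<longleftrightarrow> (\<exists>k. ys = rotate k xs)"

lemma cyclic_shift_iff_append:
  "cyclic_shift xs ys \<longleftrightarrow> (\<exists>as bs. xs = as @ bs \<and> ys = bs @ as)"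
proof
  assume "cyclic_shift xs ys"
  then obtain k where "ys = rotate k xs"
    by (auto simp: cyclic_shift_def)
  then have "xs = take (k mod length xs) xs @ drop (k mod length xs) xs"
    "ys = drop (k mod length xs) xs @ take (k mod length xs) xs"
    by (simp_all add: rotate_drop_take)
  then show "\<exists>as bs. xs = as @ bs \<and> ys = bs @ as"
    by blast
next
  assume "\<exists>as bs. xs = as @ bs \<and> ys = bs @ as"
  then show "cyclic_shift xs ys"
    unfolding cyclic_shift_def by (metis rotate_append)
qed

lemma cyclic_shift_refl [simp]: "cyclic_shift xs xs"
  unfolding cyclic_shift_def by (metis id_apply rotate0)

lemma cyclic_shift_sym: "cyclic_shift xs ys \<Longrightarrow> cyclic_shift ys xs"
  unfolding cyclic_shift_iff_append by blast

lemma cyclic_shift_trans: "cyclic_shift xs ys \<Longrightarrow> cyclic_shift ys zs \<Longrightarrow> cyclic_shift xs zs"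
  unfolding cyclic_shift_def by (metis rotate_rotate)

lemma cyclic_shift_map: "cyclic_shift xs ys \<Longrightarrow> cyclic_shift (map f xs) (map f ys)"
  unfolding cyclic_shift_def by (metis rotate_map)

lemma cyclic_shift_filter: "cyclic_shift xs ys \<Longrightarrow> cyclic_shift (filter P xs) (filter P ys)"
  unfolding cyclic_shift_iff_append by (metis filter_append)

lemma cyclic_shift_rev: "cyclic_shift xs ys \<Longrightarrow> cyclic_shift (rev xs) (rev ys)"
  unfolding cyclic_shift_iff_append by (metis rev_append)

lemma cyclic_shift_set: "cyclic_shift xs ys \<Longrightarrow> set ys = set xs"
  unfolding cyclic_shift_def by auto


section \<open>Isomorphism classes of double chord diagrams\<close>

lemma chords_on_Union: "chords_on V K \<Longrightarrow> \<Union>K = V"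
  by (simp add: chords_on_def partition_on_def)

lemma chords_on_card: "chords_on V K \<Longrightarrow> d \<in> K \<Longrightarrow> card d = 2"
  by (simp add: chords_on_def)

lemma chords_on_disjoint: "chords_on V K \<Longrightarrow> d \<in> K \<Longrightarrow> e \<in> K \<Longrightarrow> v \<in> d \<Longrightarrow> v \<in> e \<Longrightarrow> d = e"
  unfolding chords_on_def partition_on_def disjoint_def by blast

lemma chords_on_insert:
  assumes "chords_on (V - {y}) K" "y \<in> V" "x \<notin> V"
  shows "chords_on (insert x V) (insert {y, x} K)"
proof -
  have "disjnt {y, x} (\<Union>K)"
    using chords_on_Union[OF assms(1)] assms by (auto simp: disjnt_def)
  moreover have "insert x V - {y, x} = V - {y}"
    using assms by auto
  moreover have "card {y, x} = 2"
    using assms by (metis card_2_iff)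
  ultimately show ?thesis
    using assms unfolding chords_on_def by (auto simp: partition_on_insert)
qed

abbreviation points :: "double_cd \<Rightarrow> nat set" where
  "points D \<equiv> set (core1 D @ core2 D)"

text \<open>
  The two alternatives allow the core circles to be interchanged.  Stating them with
  \<open>cyclic_shift\<close> hides the amounts of rotation, so that inverses and composites need no arithmetic.
\<close>

definition double_isomorphism :: "(nat \<Rightarrow> nat) \<Rightarrow> double_cd \<Rightarrow> double_cd \<Rightarrow> bool" where
  "double_isomorphism f D E \<longleftrightarrow> inj_on f (points D) \<and>
     (cyclic_shift (map f (core1 D)) (core1 E) \<and> cyclic_shift (map f (core2 D)) (core2 E) \<or>
      cyclic_shift (map f (core2 D)) (core1 E) \<and> cyclic_shift (map f (core1 D)) (core2 E)) \<and>
     dchords E = (`) f ` dchords D"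

lemma double_iso_iff:
  "(D, E) \<in> double_iso \<longleftrightarrow> D \<in> double_cds \<and> E \<in> double_cds \<and> (\<exists>f. double_isomorphism f D E)"
  unfolding double_iso_def cyclic_shift_def double_isomorphism_def
  by (simp add: conj_disj_distribL conj_disj_distribR ex_disj_distrib)

lemma double_isomorphism_points:
  assumes "double_isomorphism f D E"
  shows "points E = f ` points D"
  using assms unfolding double_isomorphism_def by (auto dest!: cyclic_shift_set)

lemma double_isomorphism_id: "double_isomorphism (\<lambda>v. v) D D"
  by (simp add: double_isomorphism_def)

lemma double_isomorphism_inverse:
  assumes D: "D \<in> double_cds" and iso: "double_isomorphism f D E"
  shows "double_isomorphism (inv_into (points D) f) E D"
proof -
  define g where "g = inv_into (points D) f"
  have f: "inj_on f (points D)"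
    and cores: "cyclic_shift (map f (core1 D)) (core1 E) \<and> cyclic_shift (map f (core2 D)) (core2 E) \<or>
      cyclic_shift (map f (core2 D)) (core1 E) \<and> cyclic_shift (map f (core1 D)) (core2 E)"
    and ch: "dchords E = (`) f ` dchords D"
    using iso unfolding double_isomorphism_def by simp_all
  have gf: "g (f v) = v" if "v \<in> points D" for v
    using f that unfolding g_def by (rule inv_into_f_f)
  have "inj_on g (points E)"
    unfolding double_isomorphism_points[OF iso] g_def by (rule inj_on_inv_into) (rule subset_refl)
  moreover have shift: "cyclic_shift (map g ys) xs"
    if "cyclic_shift (map f xs) ys" "set xs \<subseteq> points D" for xs ys
  proof -
    have "map g (map f xs) = xs"
      using gf that(2) by (simp add: map_idI subset_iff)
    then show ?thesis
      using cyclic_shift_map[OF cyclic_shift_sym[OF that(1)], of g] by simp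
  qed
  have "set (core1 D) \<subseteq> points D" "set (core2 D) \<subseteq> points D"
    by simp_all
  then have "cyclic_shift (map g (core1 E)) (core1 D) \<and> cyclic_shift (map g (core2 E)) (core2 D) \<or>
      cyclic_shift (map g (core2 E)) (core1 D) \<and> cyclic_shift (map g (core1 E)) (core2 D)"
    using cores shift by blast
  moreover have "dchords D = (`) g ` dchords E"
  proof -
    have "g ` f ` d = d" if "d \<in> dchords D" for d
    proof -
      have "\<Union>(dchords D) = points D"
        using D chords_on_Union unfolding double_cds_def by blast
      then have "v \<in> points D" if "v \<in> d" for v
        using that \<open>d \<in> dchords D\<close> by blast
      then show ?thesis
        using gf unfolding image_image by simp
    qed
    then show ?thesis
      unfolding ch image_image by simp
  qed
  ultimately show ?thesis
    unfolding double_isomorphism_def g_def by blast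
qed

lemma double_isomorphism_comp:
  assumes f: "double_isomorphism f D E" and g: "double_isomorphism g E G"
  shows "double_isomorphism (g \<circ> f) D G"
proof -
  have "inj_on (g \<circ> f) (points D)"
    using f g double_isomorphism_points[OF f] unfolding double_isomorphism_def
    by (metis comp_inj_on)
  moreover have comp: "cyclic_shift (map (g \<circ> f) xs) zs"
    if "cyclic_shift (map f xs) ys" "cyclic_shift (map g ys) zs" for xs ys zs
    using cyclic_shift_trans[OF cyclic_shift_map[OF that(1), of g] that(2)] by simp
  have "cyclic_shift (map (g \<circ> f) (core1 D)) (core1 G) \<and> cyclic_shift (map (g \<circ> f) (core2 D)) (core2 G) \<or>
      cyclic_shift (map (g \<circ> f) (core2 D)) (core1 G) \<and> cyclic_shift (map (g \<circ> f) (core1 D)) (core2 G)"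
    using f g comp unfolding double_isomorphism_def by meson
  moreover have "dchords G = (`) (g \<circ> f) ` dchords D"
    using f g unfolding double_isomorphism_def by (simp add: image_image image_comp)
  ultimately show ?thesis
    unfolding double_isomorphism_def by blast
qed

lemma equiv_double_iso: "equiv double_cds double_iso"
proof (rule equivI)
  show "double_iso \<subseteq> double_cds \<times> double_cds"
    by (auto simp: double_iso_def)
  show "refl_on double_cds double_iso"
    by (rule refl_onI) (use double_isomorphism_id double_iso_iff in blast)
  show "sym double_iso"
    by (rule symI) (use double_isomorphism_inverse double_iso_iff in blast)
  show "trans double_iso"
    by (rule transI, unfold double_iso_iff) (metis double_isomorphism_comp)
qed

text \<open>
  All isomorphisms constructed below keep the order of the two circles.
\<close>

lemma double_class_eqI:
  assumes "D \<in> double_cds" "E \<in> double_cds" "inj_on f (points D)"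
    "cyclic_shift (map f (core1 D)) (core1 E)" "cyclic_shift (map f (core2 D)) (core2 E)"
    "dchords E = (`) f ` dchords D"
  shows "double_class D = double_class E"
  unfolding double_class_def
proof (rule equiv_class_eq[OF equiv_double_iso])
  have "double_isomorphism f D E"
    using assms(3-6) by (simp add: double_isomorphism_def)
  then show "(D, E) \<in> double_iso"
    using assms(1,2) double_iso_iff by blast
qed


section \<open>Copies of points and positions of chords\<close>

text \<open>
  Sums in \<open>\<int>/2\<close> index circles, sides and framings, so they are kept as sums
  instead of being rewritten to exclusive disjunctions.
\<close>

declare add_bit_eq_xor [simp del]

definition copy :: "bit \<Rightarrow> nat \<Rightarrow> nat" where
  "copy k = (if k = 0 then copy1 else copy2)"

lemma copy_eq_iff [simp]: "copy i u = copy j v \<longleftrightarrow> i = j \<and> u = v"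
  by (cases i; cases j; auto simp: copy_def copy1_def copy2_def; presburger)

lemma inj_copy: "inj_on (copy k) A"
  by (auto simp: inj_on_def)

lemma copy_cases: obtains k v where "w = copy k v"
proof (cases "even w")
  case True
  then show ?thesis using that[of 0 "w div 2"] by (simp add: copy_def copy1_def)
next
  case False
  then show ?thesis using that[of 1 "w div 2"] by (simp add: copy_def copy2_def)
qed

text \<open>
  The two positions of a chord are indexed by the circle on which the copy of \<open>u\<close> lies; the
  framing is the difference between the circles of the two endpoints.  Both framings obey this
  one formula, which makes later case distinctions on framings superfluous.
\<close>

lemma positions_pair:
  assumes "u \<noteq> v"
  shows "positions D {u, v} = (\<lambda>i. {copy i u, copy (i + framing D {u, v}) v}) ` {0, 1}"
proof (cases "framing D {u, v}")
  case zero
  then show ?thesis by (auto simp: positions_def copy_def)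
next
  case one
  have 11: "1 + 1 = (0::bit)" by simp
  have "positions D {u, v} = {{copy1 a, copy2 b} | a b. {u, v} = {a, b}}"
    using one by (simp add: positions_def)
  also have "\<dots> = {{copy1 u, copy2 v}, {copy2 u, copy1 v}}"
    by (auto simp: doubleton_eq_iff)
  finally show ?thesis
    using one 11 by (simp add: copy_def)
qed

lemma positions_props:
  assumes "card d = 2" "e \<in> positions D d"
  shows "card e = 2" "copy k v \<in> e \<Longrightarrow> v \<in> d"
proof -
  obtain u w where d: "d = {u, w}" "u \<noteq> w"
    using assms(1) by (meson card_2_iff)
  then obtain i where e: "e = {copy i u, copy (i + framing D {u, w}) w}"
    using assms(2) unfolding d(1) positions_pair[OF d(2)] by blast
  show "card e = 2" "copy k v \<in> e \<Longrightarrow> v \<in> d"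
    using d by (auto simp: e card_2_iff)
qed

text \<open>
  A position of a chord only uses copies of the endpoints of that chord.  As distinct chords are
  disjoint, so are their positions, and whether a copy of a point is marked can be read off from
  the position of its own chord.
\<close>

context
  fixes V C D \<sigma>
  assumes C: "chords_on V C" and \<sigma>: "\<sigma> \<in> PiE C (positions D)"
begin

lemma family_member:
  assumes "d \<in> C"
  shows "card (\<sigma> d) = 2" "copy k v \<in> \<sigma> d \<Longrightarrow> v \<in> d"
  using positions_props[OF chords_on_card[OF C assms] PiE_mem[OF \<sigma> assms]] by blast+

lemma copy_in_family_iff:
  assumes "v \<in> d" "d \<in> C"
  shows "copy k v \<in> \<Union>(\<sigma> ` C) \<longleftrightarrow> copy k v \<in> \<sigma> d"
proof
  assume "copy k v \<in> \<Union>(\<sigma> ` C)"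
  then obtain e where e: "e \<in> C" "copy k v \<in> \<sigma> e"
    by blast
  then have "v \<in> e"
    using family_member(2) by blast
  then show "copy k v \<in> \<sigma> d"
    using chords_on_disjoint[OF C] e assms by blast
qed (use assms in blast)

lemma family_copy_in: "copy k v \<in> \<Union>(\<sigma> ` C) \<Longrightarrow> v \<in> V"
  using family_member(2) chords_on_Union[OF C] by blast

lemma chords_on_family: "chords_on (\<Union>(\<sigma> ` C)) (\<sigma> ` C)"
proof -
  have card: "card e = 2" if "e \<in> \<sigma> ` C" for e
    using that family_member(1) by blast
  moreover have "disjnt e e'" if ee: "e \<in> \<sigma> ` C" "e' \<in> \<sigma> ` C" "e \<noteq> e'" for e e'
  proof -
    obtain d d' where d: "d \<in> C" "d' \<in> C" "e = \<sigma> d" "e' = \<sigma> d'"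
      using ee by blast
    have False if "w \<in> e" "w \<in> e'" for w
    proof -
      obtain k v where w: "w = copy k v"
        by (rule copy_cases)
      have "v \<in> d" "v \<in> d'"
        using that d w family_member(2) by blast+
      then show False
        using chords_on_disjoint[OF C] d ee(3) by blast
    qed
    then show ?thesis
      by (auto simp: disjnt_def)
  qed
  moreover have "{} \<notin> \<sigma> ` C"
    using card by (metis card.empty zero_neq_numeral)
  ultimately show ?thesis
    unfolding chords_on_def by (intro conjI partition_onI) blast+
qed

end


section \<open>The double diagram on the two copies of a circle\<close>

text \<open>
  The diagram \<open>double_of\<close> as a function of the circle and the set of chosen chords, so that a
  point can be inserted into the circle and a chord into the set independently.
\<close>

definition double_on :: "nat list \<Rightarrow> nat set set \<Rightarrow> double_cd" where
  "double_on c K =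
     \<lparr>core1 = filter (\<lambda>v. v \<in> \<Union>K) (map (copy 0) c),
      core2 = filter (\<lambda>v. v \<in> \<Union>K) (map (copy 1) (rev c)),
      dchords = K\<rparr>"

lemma double_of_eq: "double_of D \<sigma> = double_on (core D) (\<sigma> ` chords D)"
  by (simp add: double_of_def double_on_def copy_def Let_def)

lemma distinct_double_on:
  assumes "distinct c"
  shows "distinct (filter P (map (copy 0) c) @ filter P (map (copy 1) (rev c)))"
  using assms by (auto simp: distinct_map inj_copy)

lemma set_double_on:
  assumes "\<And>k v. copy k v \<in> W \<Longrightarrow> v \<in> set c"
  shows "set (filter (\<lambda>v. v \<in> W) (map (copy 0) c) @ filter (\<lambda>v. v \<in> W) (map (copy 1) (rev c))) = W"
proof -
  have "w \<in> copy 0 ` set c \<union> copy 1 ` set c" if "w \<in> W" for w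
  proof -
    obtain k v where "w = copy k v"
      by (rule copy_cases)
    then show ?thesis
      using assms that by (cases k) auto
  qed
  then show ?thesis by auto
qed

lemma double_on_in:
  assumes "distinct c" "chords_on (\<Union>K) K" "\<And>k v. copy k v \<in> \<Union>K \<Longrightarrow> v \<in> set c"
  shows "double_on c K \<in> double_cds"
  using distinct_double_on[OF assms(1)] set_double_on[OF assms(3)] assms(2)
  unfolding double_cds_def double_on_def
  by (simp del: set_append set_filter distinct_append filter_map Union_iff)

lemma double_of_in:
  assumes "D \<in> framed_cds" "\<sigma> \<in> PiE (chords D) (positions D)"
  shows "double_of D \<sigma> \<in> double_cds"
proof -
  have C: "chords_on (set (core D)) (chords D)" "distinct (core D)"
    using assms(1) by (auto simp: framed_cds_def)
  show ?thesis
    unfolding double_of_eq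
    using C chords_on_family[OF C(1) assms(2)] family_copy_in[OF C(1) assms(2)]
    by (intro double_on_in) auto
qed

text \<open>
  The map on copies induced by a map of points: \<open>w mod 2\<close> tells the circle of the
  copy \<open>w\<close>, and \<open>w div 2\<close> the point.
\<close>

definition map_copies :: "(nat \<Rightarrow> nat) \<Rightarrow> nat \<Rightarrow> nat" where
  "map_copies f w = copy (of_nat w) (f (w div 2))"

lemma map_copies_copy [simp]: "map_copies f (copy k v) = copy k (f v)"
  by (cases k) (auto simp: map_copies_def copy_def copy1_def copy2_def)

text \<open>
  The isomorphism is \<open>map_copies f\<close>.  Marked points are kept and unmarked ones removed on both
  sides alike, so the filtered circles still differ by a rotation, and reversal of the second
  circle turns a rotation into a rotation.
\<close>

lemma double_class_double_on_cong:
  assumes c: "distinct c" "inj_on f (set c)" "cyclic_shift (map f c) c'"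
    and K: "chords_on (\<Union>K) K" "\<And>k v. copy k v \<in> \<Union>K \<Longrightarrow> v \<in> set c"
    and K': "chords_on (\<Union>K') K'" "K' = (`) (map_copies f) ` K"
  shows "double_class (double_on c K) = double_class (double_on c' K')"
proof (rule double_class_eqI)
  let ?F = "map_copies f"
  have F: "?F w \<in> \<Union>K' \<longleftrightarrow> w \<in> \<Union>K" if w: "w = copy k v" "v \<in> set c" for w k v
  proof
    assume "?F w \<in> \<Union>K'"
    then obtain w' where w': "w' \<in> \<Union>K" "?F w = ?F w'"
      unfolding K'(2) by blast
    obtain k' v' where "w' = copy k' v'"
      by (rule copy_cases)
    then have "w' = w"
      using w w' K(2) c(2) by (auto dest: inj_onD)
    then show "w \<in> \<Union>K"
      using w' by simp
  qed (auto simp: K'(2))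
  have set_c': "set c' = f ` set c"
    using cyclic_shift_set[OF c(3)] by simp
  have "distinct (map f c)"
    using c by (simp add: distinct_map)
  then have "distinct c'"
    using c(3) by (auto simp: cyclic_shift_def)
  moreover have "v \<in> set c'" if "copy k v \<in> \<Union>K'" for k v
  proof -
    obtain w' where w': "w' \<in> \<Union>K" "copy k v = ?F w'"
      using \<open>copy k v \<in> \<Union>K'\<close> unfolding K'(2) by blast
    obtain k' v' where "w' = copy k' v'"
      by (rule copy_cases)
    then show ?thesis
      using w' K(2) set_c' by auto
  qed
  ultimately show "double_on c' K' \<in> double_cds"
    using K'(1) by (intro double_on_in)
  show "double_on c K \<in> double_cds"
    using c K by (intro double_on_in)
  show "inj_on ?F (points (double_on c K))"
  proof (rule inj_on_subset)
    show "inj_on ?F (copy 0 ` set c \<union> copy 1 ` set c)"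
    proof (rule inj_onI)
      fix w w' assume w: "w \<in> copy 0 ` set c \<union> copy 1 ` set c" "w' \<in> copy 0 ` set c \<union> copy 1 ` set c"
        and eq: "?F w = ?F w'"
      from w obtain k v k' v' where "w = copy k v" "v \<in> set c" "w' = copy k' v'" "v' \<in> set c"
        by blast
      then show "w = w'"
        using eq inj_onD[OF c(2), of v v'] by simp
    qed
  qed (auto simp: double_on_def)
  have map_filter: "map ?F (filter (\<lambda>v. v \<in> \<Union>K) (map (copy k) a)) =
      filter (\<lambda>v. v \<in> \<Union>K') (map (copy k) (map f a))" if "set a = set c" for k a
  proof -
    have "filter (\<lambda>v. v \<in> \<Union>K') (map (copy k) (map f a)) =
        filter (\<lambda>v. v \<in> \<Union>K') (map ?F (map (copy k) a))"
      unfolding map_map comp_def map_copies_copy ..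
    also have "\<dots> = map ?F (filter (\<lambda>w. ?F w \<in> \<Union>K') (map (copy k) a))"
      by (simp only: filter_map o_def)
    also have "filter (\<lambda>w. ?F w \<in> \<Union>K') (map (copy k) a) = filter (\<lambda>v. v \<in> \<Union>K) (map (copy k) a)"
    proof (rule filter_cong[OF refl])
      fix w assume "w \<in> set (map (copy k) a)"
      then obtain v where "w = copy k v" "v \<in> set c"
        using \<open>set a = set c\<close> by auto
      then show "?F w \<in> \<Union>K' \<longleftrightarrow> w \<in> \<Union>K"
        by (rule F)
    qed
    finally show ?thesis by simp
  qed
  show "cyclic_shift (map ?F (core1 (double_on c K))) (core1 (double_on c' K'))"
    using cyclic_shift_filter[OF cyclic_shift_map[OF c(3)]]
    by (simp only: double_on_def double_cd.simps map_filter[OF refl])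
  show "cyclic_shift (map ?F (core2 (double_on c K))) (core2 (double_on c' K'))"
    using cyclic_shift_filter[OF cyclic_shift_map[OF cyclic_shift_rev[OF c(3)]]]
    by (simp only: double_on_def double_cd.simps map_filter[OF set_rev] rev_map)
  show "dchords (double_on c' K') = (`) ?F ` dchords (double_on c K)"
    using K'(2) by (simp add: double_on_def)
qed


section \<open>Independence of the representative\<close>

lemma positions_image:
  assumes "inj_on f d" "card d = 2" "framing E (f ` d) = framing D d"
  shows "positions E (f ` d) = (`) (map_copies f) ` positions D d"
proof -
  obtain u v where d: "d = {u, v}" "u \<noteq> v"
    using assms(2) by (meson card_2_iff)
  then have "f u \<noteq> f v"
    using assms(1) by (auto simp: inj_on_def)
  then show ?thesis
    using assms(3) d by (simp add: positions_pair)
qed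

text \<open>
  An injection \<open>f\<close> with left inverse \<open>g\<close> carries a family of positions to one of the image
  diagram, and \<open>g\<close> carries it back.  Used for \<open>f\<close> and for its inverse, this makes the
  correspondence of families a bijection.
\<close>

lemma transport_family:
  assumes gf: "\<And>v. v \<in> V \<Longrightarrow> g (f v) = v" and C: "chords_on V C"
    and framing: "\<And>d. d \<in> C \<Longrightarrow> framing E (f ` d) = framing D d"
    and \<sigma>: "\<sigma> \<in> PiE C (positions D)"
  defines "\<tau> \<equiv> \<lambda>e\<in>(`) f ` C. map_copies f ` \<sigma> (g ` e)"
  shows "\<tau> \<in> PiE ((`) f ` C) (positions E)"
    and "(\<lambda>d\<in>C. map_copies g ` \<tau> (f ` d)) = \<sigma>"
    and "\<tau> ` (`) f ` C = (`) (map_copies f) ` \<sigma> ` C"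
proof -
  have dV: "d \<subseteq> V" if "d \<in> C" for d
    using that chords_on_Union[OF C] by blast
  have gfd: "g ` f ` d = d" if "d \<in> C" for d
    using dV[OF that] gf by (force simp: image_image)
  have inj: "inj_on f d" if "d \<in> C" for d
    using dV[OF that] gf by (metis inj_on_inverseI subsetD)
  have \<tau>: "\<tau> (f ` d) = map_copies f ` \<sigma> d" if "d \<in> C" for d
    using that by (simp add: \<tau>_def gfd)
  show "\<tau> \<in> PiE ((`) f ` C) (positions E)"
  proof (rule PiE_I)
    fix e assume "e \<in> (`) f ` C"
    then obtain d where d: "d \<in> C" "e = f ` d"
      by blast
    then have "\<sigma> d \<in> positions D d"
      using \<sigma> by (auto dest: PiE_mem)
    then show "\<tau> e \<in> positions E e"
      using d \<tau> positions_image[OF inj chords_on_card[OF C] framing] by simp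
  qed (auto simp: \<tau>_def)
  show "(\<lambda>d\<in>C. map_copies g ` \<tau> (f ` d)) = \<sigma>"
  proof
    fix d
    show "(\<lambda>d\<in>C. map_copies g ` \<tau> (f ` d)) d = \<sigma> d"
    proof (cases "d \<in> C")
      case True
      have "map_copies g (map_copies f w) = w" if "w \<in> \<sigma> d" for w
      proof -
        obtain k v where w: "w = copy k v"
          by (rule copy_cases)
        have "\<sigma> d \<in> positions D d"
          using \<sigma> True by (auto dest: PiE_mem)
        then have "v \<in> d"
          using positions_props(2)[OF chords_on_card[OF C True]] that w by blast
        then show ?thesis
          using dV[OF True] gf w by auto
      qed
      then show ?thesis
        using True \<tau> by (force simp: image_image)
    next
      case False
      then show ?thesis
        using PiE_arb[OF \<sigma> False] by simp
    qed
  qed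
  show "\<tau> ` (`) f ` C = (`) (map_copies f) ` \<sigma> ` C"
    unfolding image_image using \<tau> by (intro image_cong refl) simp
qed

lemma framed_iso_iff:
  "(D, E) \<in> framed_iso \<longleftrightarrow> D \<in> framed_cds \<and> E \<in> framed_cds \<and>
     (\<exists>f. inj_on f (set (core D)) \<and> cyclic_shift (map f (core D)) (core E) \<and>
        chords E = (`) f ` chords D \<and> (\<forall>d\<in>chords D. framing E (f ` d) = framing D d))"
  unfolding framed_iso_def cyclic_shift_def by (simp only: mem_Collect_eq split_conv ex_simps)

lemma psi_diagram_iso:
  assumes "(D, E) \<in> framed_iso"
  shows "psi_diagram D = psi_diagram E"
proof -
  obtain f where D: "D \<in> framed_cds" and E: "E \<in> framed_cds"
    and f: "inj_on f (set (core D))" and core: "cyclic_shift (map f (core D)) (core E)"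
    and ch: "chords E = (`) f ` chords D"
    and fr_ball: "\<forall>d\<in>chords D. framing E (f ` d) = framing D d"
    using assms unfolding framed_iso_iff by (elim conjE exE)
  have fr: "framing E (f ` d) = framing D d" if "d \<in> chords D" for d
    using fr_ball that by (rule bspec)
  have CD: "chords_on (set (core D)) (chords D)" "distinct (core D)"
    and CE: "chords_on (set (core E)) (chords E)"
    using D E by (auto simp: framed_cds_def)
  define g where "g = inv_into (set (core D)) f"
  have gf: "g (f v) = v" if "v \<in> set (core D)" for v
    using f that by (simp add: g_def)
  have fg: "f (g v) = v" if "v \<in> set (core E)" for v
    using that cyclic_shift_set[OF core] gf by auto
  have gfd: "g ` f ` d = d" if "d \<in> chords D" for d
  proof -
    have "g (f v) = v" if "v \<in> d" for v
      using gf that \<open>d \<in> chords D\<close> chords_on_Union[OF CD(1)] by blast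
    then show ?thesis
      unfolding image_image by simp
  qed
  have ch': "chords D = (`) g ` chords E"
    using ch gfd by (simp add: image_image)
  have fr': "framing D (g ` e) = framing E e" if "e \<in> chords E" for e
    using that ch fr gfd by auto
  define to where "to = (\<lambda>\<sigma>. \<lambda>e\<in>(`) f ` chords D. map_copies f ` \<sigma> (g ` e))"
  define fro where "fro = (\<lambda>\<tau>. \<lambda>d\<in>(`) g ` chords E. map_copies g ` \<tau> (f ` d))"
  show ?thesis
    unfolding psi_diagram_def
  proof (rule sum.reindex_bij_witness[where j = to and i = fro])
    fix \<sigma> assume \<sigma>: "\<sigma> \<in> PiE (chords D) (positions D)"
    note T = transport_family[where g = g and f = f, OF gf CD(1) fr \<sigma>]
    show "fro (to \<sigma>) = \<sigma>"
      using T(2) unfolding to_def fro_def ch'[symmetric] .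
    show to: "to \<sigma> \<in> PiE (chords E) (positions E)"
      using T(1) unfolding to_def ch .
    have "double_class (double_of D \<sigma>) = double_class (double_of E (to \<sigma>))"
      unfolding double_of_eq
    proof (rule double_class_double_on_cong)
      show "cyclic_shift (map f (core D)) (core E)"
        by (rule core)
      show "to \<sigma> ` chords E = (`) (map_copies f) ` \<sigma> ` chords D"
        using T(3) unfolding to_def ch .
      show "distinct (core D)" "inj_on f (set (core D))"
        by (rule CD(2), rule f)
      show "chords_on (\<Union>(\<sigma> ` chords D)) (\<sigma> ` chords D)"
        by (rule chords_on_family[OF CD(1) \<sigma>])
      show "chords_on (\<Union>(to \<sigma> ` chords E)) (to \<sigma> ` chords E)"
        by (rule chords_on_family[OF CE to])
      show "v \<in> set (core D)" if "copy k v \<in> \<Union>(\<sigma> ` chords D)" for k v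
        using that by (rule family_copy_in[OF CD(1) \<sigma>])
    qed
    then show "frag_of (double_class (double_of E (to \<sigma>))) =
        frag_of (double_class (double_of D \<sigma>))"
      by simp
  next
    fix \<tau> assume \<tau>: "\<tau> \<in> PiE (chords E) (positions E)"
    note T = transport_family[where g = f and f = g, OF fg CE fr' \<tau>]
    show "to (fro \<tau>) = \<tau>"
      using T(2) unfolding to_def fro_def ch[symmetric] .
    show "fro \<tau> \<in> PiE (chords D) (positions D)"
      using T(1) unfolding fro_def ch'[symmetric] .
  qed
qed

lemma framed_iso_refl: "D \<in> framed_cds \<Longrightarrow> (D, D) \<in> framed_iso"
proof -
  assume D: "D \<in> framed_cds"
  have "inj_on id (set (core D)) \<and> cyclic_shift (map id (core D)) (core D) \<and>
      chords D = (`) id ` chords D \<and> (\<forall>d\<in>chords D. framing D (id ` d) = framing D d)"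
    by simp
  then show ?thesis
    unfolding framed_iso_iff by (intro conjI D exI[of _ id]) simp_all
qed

lemma some_in_framed_class:
  assumes "D \<in> framed_cds"
  shows "(D, SOME E. E \<in> framed_class D) \<in> framed_iso"
proof -
  have "(SOME E. E \<in> framed_class D) \<in> framed_class D"
    using framed_iso_refl[OF assms]
    by (intro someI[of "\<lambda>E. E \<in> framed_class D" D]) (simp add: framed_class_def)
  then show ?thesis
    by (simp add: framed_class_def)
qed

lemma psi_frag_of:
  assumes "D \<in> framed_cds"
  shows "psi (frag_of (framed_class D)) = psi_diagram D"
  using psi_diagram_iso[OF some_in_framed_class[OF assms]] by (simp add: psi_def)

lemma frag_of_double_class_in_M2:
  "D \<in> double_cds \<Longrightarrow> frag_of (double_class D) \<in> carrier M2"
  by (simp add: M2_def double_class_def quotientI)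

lemma psi_diagram_in_M2:
  assumes "D \<in> framed_cds"
  shows "psi_diagram D \<in> carrier M2"
proof -
  have "frag_of (double_class (double_of D \<sigma>)) \<in> carrier M2"
    if "\<sigma> \<in> PiE (chords D) (positions D)" for \<sigma>
    using double_of_in[OF assms that] by (rule frag_of_double_class_in_M2)
  then show ?thesis
    unfolding psi_diagram_def M2_def by (intro sum_closed_free_Abelian_group)
qed

lemma psi_hom: "psi \<in> hom Mf M2"
proof (rule homI)
  fix x assume "x \<in> carrier Mf"
  then have keys: "Poly_Mapping.keys x \<subseteq> framed_cds // framed_iso"
    by (simp add: Mf_def)
  have "psi_diagram (SOME D. D \<in> X) \<in> carrier M2" if X: "X \<in> framed_cds // framed_iso" for X
  proof -
    obtain D where "D \<in> framed_cds" "X = framed_class D"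
      using X by (auto simp: quotient_def framed_class_def)
    then show ?thesis
      using psi_diagram_in_M2 some_in_framed_class by (auto simp: framed_iso_def)
  qed
  then show "psi x \<in> carrier M2"
    using keys keys_frag_extend[of "\<lambda>X. psi_diagram (SOME D. D \<in> X)" x]
    unfolding psi_def M2_def by fastforce
next
  show "psi (x \<otimes>\<^bsub>Mf\<^esub> y) = psi x \<otimes>\<^bsub>M2\<^esub> psi y" for x y
    by (simp add: Mf_def M2_def psi_def frag_extend_add)
qed


section \<open>Inserting an endpoint\<close>

text \<open>
  The side of \<open>r\<close> is an element of \<open>\<int>/2\<close>: 0 is before and 1 is after.
\<close>

definition ins :: "bit \<Rightarrow> nat \<Rightarrow> nat \<Rightarrow> nat list \<Rightarrow> nat list" where
  "ins s = (if s = 0 then ins_before else ins_after)"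

lemma ins_Nil [simp]: "ins s x r [] = []"
  by (simp add: ins_def ins_before_def ins_after_def)

lemma ins_Cons [simp]:
  "ins s x r (z # c) = (if z = r then if s = 0 then [x, z] else [z, x] else [z]) @ ins s x r c"
  by (simp add: ins_def ins_before_def ins_after_def)

lemma ins_append [simp]: "ins s x r (c @ c') = ins s x r c @ ins s x r c'"
  by (simp add: ins_def ins_before_def ins_after_def)

lemma ins_notin: "r \<notin> set c \<Longrightarrow> ins s x r c = c"
  by (induction c) auto

lemma set_ins: "set (ins s x r c) = (if r \<in> set c then insert x (set c) else set c)"
  by (induction c) auto

lemma distinct_ins: "distinct c \<Longrightarrow> x \<notin> set c \<Longrightarrow> distinct (ins s x r c)"
  by (induction c) (auto simp: set_ins ins_notin)

text \<open>
  This exchange of sides is the source of all signs: it is what happens on the second circle.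
\<close>

lemma rev_ins: "rev (ins s x r c) = ins (1 + s) x r (rev c)"
  by (induction c; cases s) auto

lemma filter_map_ins:
  assumes "inj g" "P (g x)" "P (g r)"
  shows "filter P (map g (ins s x r c)) = ins s (g x) (g r) (filter P (map g c))"
  using assms by (induction c) (auto dest: injD)

lemma filter_map_ins_removed:
  "\<not> P (g x) \<Longrightarrow> filter P (map g (ins s x r c)) = filter P (map g c)"
  by (induction c) auto

text \<open>
  The side is only visible when both the new point and its neighbour \<open>r\<close> survive the filter.
\<close>

lemma filter_map_ins_side:
  "\<not> (P (g x) \<and> P (g r)) \<Longrightarrow> filter P (map g (ins s x r c)) = filter P (map g (ins s' x r c))"
  by (induction c) auto

lemma map_ins_rename:
  assumes "x \<notin> set c" "r \<noteq> x"
  shows "map (id(x := x')) (ins s x r c) = ins s x' r c"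
  using assms by (induction c) auto


section \<open>Adding a chord to a double diagram\<close>

lemma double_add_in:
  assumes B: "double_4T_data B p q y x" and r: "r \<in> points B"
  shows "double_add B y x (ins s x r) \<in> double_cds"
proof -
  have d: "distinct (core1 B @ core2 B)" and y: "y \<in> points B"
    and C: "chords_on (points B - {y}) (dchords B)" and x: "x \<notin> points B"
    using B unfolding double_4T_data_def by simp_all
  have "set (ins s x r (core1 B) @ ins s x r (core2 B)) = insert x (points B)"
    using r by (auto simp: set_ins)
  moreover have "distinct (ins s x r (core1 B) @ ins s x r (core2 B))"
    using d x r by (auto simp: set_ins distinct_ins)
  ultimately show ?thesis
    using chords_on_insert[OF C y x] by (simp add: double_cds_def double_add_def)
qed

text \<open>
  If \<open>b\<close> has framing 1, then the new endpoint near \<open>p\<close> and the one near \<open>q\<close> are copies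
  of \<open>x\<close> on different circles, whereas a double relation uses a single name for all four terms.
\<close>

lemma double_class_add_rename:
  assumes B: "double_4T_data B p q y x" and x': "x' \<notin> points B" and r: "r \<in> points B"
  shows "double_class (double_add B y x (ins s x r)) = double_class (double_add B y x' (ins s x' r))"
proof (rule double_class_eqI)
  let ?f = "id(x := x')"
  have y: "y \<in> points B" and C: "chords_on (points B - {y}) (dchords B)" and x: "x \<notin> points B"
    using B unfolding double_4T_data_def by simp_all
  have "double_4T_data B p q y x'"
    using B x' unfolding double_4T_data_def by simp
  then show "double_add B y x' (ins s x' r) \<in> double_cds"
    using r by (rule double_add_in)
  show "double_add B y x (ins s x r) \<in> double_cds"
    using B r by (rule double_add_in)
  have "points (double_add B y x (ins s x r)) \<subseteq> insert x (points B)"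
    by (auto simp: double_add_def set_ins)
  moreover have "inj_on ?f (insert x (points B))"
    using x x' by (auto simp: inj_on_def)
  ultimately show "inj_on ?f (points (double_add B y x (ins s x r)))"
    by (meson inj_on_subset)
  have "x \<notin> set (core1 B)" "x \<notin> set (core2 B)" "r \<noteq> x"
    using x r by auto
  then show "cyclic_shift (map ?f (core1 (double_add B y x (ins s x r)))) (core1 (double_add B y x' (ins s x' r)))"
    "cyclic_shift (map ?f (core2 (double_add B y x (ins s x r)))) (core2 (double_add B y x' (ins s x' r)))"
    by (simp_all add: double_add_def map_ins_rename)
  have "?f ` e = e" if "e \<in> dchords B" for e
  proof -
    have "x \<notin> e"
      using that x chords_on_Union[OF C] by blast
    then show ?thesis
      by (auto simp: image_iff)
  qed
  then have "(`) ?f ` dchords B = dchords B"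
    by simp
  moreover have "?f ` {y, x} = {y, x'}"
    using x y by auto
  ultimately show "dchords (double_add B y x' (ins s x' r)) = (`) ?f ` dchords (double_add B y x (ins s x r))"
    by (simp add: double_add_def)
qed


section \<open>The image of a single term of a framed relation\<close>

text \<open>
  The diagram with marked point \<open>y'\<close> from which the four terms of a double relation are built.
\<close>

definition double_base :: "nat list \<Rightarrow> nat set set \<Rightarrow> nat \<Rightarrow> double_cd" where
  "double_base c K y' =
     \<lparr>core1 = filter (\<lambda>v. v \<in> insert y' (\<Union>K)) (map (copy 0) c),
      core2 = filter (\<lambda>v. v \<in> insert y' (\<Union>K)) (map (copy 1) (rev c)),
      dchords = K\<rparr>"

text \<open>
  If the copy of \<open>r\<close> on the circle of the new endpoint is unmarked, it disappears from that
  circle, and with it the difference between the two sides.  The two double diagrams are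
  equal, not just isomorphic.
\<close>

lemma double_on_ins_unmarked:
  assumes "copy k r \<notin> \<Union>K" "r \<noteq> y" "r \<noteq> x" "x \<noteq> y" "\<And>j. copy j x \<notin> \<Union>K"
  shows "double_on (ins s x r c) (insert {copy i y, copy k x} K) =
    double_on (ins s' x r c) (insert {copy i y, copy k x} K)"
proof -
  let ?P = "\<lambda>v. v \<in> \<Union>(insert {copy i y, copy k x} K)"
  have "\<not> (?P (copy j x) \<and> ?P (copy j r))" for j
    using assms by auto
  then have eq: "filter ?P (map (copy j) (ins t x r a)) = filter ?P (map (copy j) (ins t' x r a))" for j t t' a
    by (rule filter_map_ins_side)
  then show ?thesis
    unfolding double_on_def rev_ins
    by (simp only: eq[of 0 s c s'] eq[of 1 "1 + s" "rev c" "1 + s'"])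
qed

text \<open>
  On circle \<open>k\<close> the insertion survives, on side \<open>s\<close> for \<open>k = 0\<close> and on the other side for
  \<open>k = 1\<close>, where the circle is reversed; hence side \<open>s + k\<close>.  On the other circle the new
  point is removed again.
\<close>

lemma double_on_ins_marked:
  assumes r: "copy k r \<in> \<Union>K" and x: "x \<notin> set c" "\<And>j. copy j x \<notin> \<Union>K" "x \<noteq> y"
  shows "double_on (ins s x r c) (insert {copy i y, copy k x} K) =
    double_add (double_base c K (copy i y)) (copy i y) (copy k x) (ins (s + k) (copy k x) (copy k r))"
proof -
  let ?P = "\<lambda>v. v \<in> \<Union>(insert {copy i y, copy k x} K)"
  let ?Q = "\<lambda>v. v \<in> insert (copy i y) (\<Union>K)"
  have PQ: "filter ?P (map (copy j) a) = filter ?Q (map (copy j) a)" if "set a = set c" for j a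
    by (rule filter_cong[OF refl]) (use x that in auto)
  have same: "filter ?P (map (copy k) (ins t x r a)) =
      ins t (copy k x) (copy k r) (filter ?Q (map (copy k) a))" if a: "set a = set c" for t a
    unfolding PQ[OF a, symmetric]
    by (rule filter_map_ins) (use r inj_copy in auto)
  have other: "filter ?P (map (copy j) (ins t x r a)) =
      ins t' (copy k x) (copy k r) (filter ?Q (map (copy j) a))"
    if j: "j \<noteq> k" and a: "set a = set c" for j t t' a
  proof -
    have "filter ?P (map (copy j) (ins t x r a)) = filter ?P (map (copy j) a)"
      by (rule filter_map_ins_removed) (use j x in auto)
    moreover have "copy k r \<notin> set (filter ?Q (map (copy j) a))"
      using j by auto
    ultimately show ?thesis
      unfolding PQ[OF a] by (simp only: ins_notin not_False_eq_True)
  qed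
  have "filter ?P (map (copy 0) (ins s x r c)) =
      ins (s + k) (copy k x) (copy k r) (filter ?Q (map (copy 0) c))"
  proof (cases "k = 0")
    case True
    then show ?thesis
      using same[OF refl, of s] by (simp only: add_0_right)
  next
    case False
    then show ?thesis
      by (intro other) simp_all
  qed
  moreover have "filter ?P (map (copy 1) (ins (1 + s) x r (rev c))) =
      ins (s + k) (copy k x) (copy k r) (filter ?Q (map (copy 1) (rev c)))"
  proof (cases "k = 1")
    case True
    then show ?thesis
      using same[OF set_rev, of "1 + s"] by (simp only: add.commute)
  next
    case False
    then show ?thesis
      by (intro other) simp_all
  qed
  ultimately show ?thesis
    unfolding double_on_def double_add_def double_base_def rev_ins double_cd.simps by blast
qed


section \<open>Compatibility with the relations\<close>

lemma framed_add_in: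
  assumes B: "framed_4T_data B p q y x" and r: "r \<in> {p, q}"
  shows "framed_add B y x \<epsilon> (ins s x r) \<in> framed_cds"
proof -
  have d: "distinct (core B)" and y: "y \<in> set (core B)" and x: "x \<notin> set (core B)"
    and C: "chords_on (set (core B) - {y}) (chords B)" and pq: "{p, q} \<in> chords B"
    using B unfolding framed_4T_data_def by simp_all
  have "r \<in> set (core B)"
    using chords_on_Union[OF C] pq r by blast
  then show ?thesis
    using d x chords_on_insert[OF C y x]
    by (simp add: framed_cds_def framed_add_def set_ins distinct_ins)
qed

text \<open>
  A family for the enlarged diagram is a family for \<open>B\<close> together with a position of the new
  chord, and the latter is determined by the circle \<open>i\<close> of the copy of \<open>y\<close>.
\<close>

lemma psi_diagram_framed_add:
  assumes B: "framed_4T_data B p q y x"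
  shows "psi_diagram (framed_add B y x \<epsilon> (ins s x r)) =
    (\<Sum>\<tau>\<in>PiE (chords B) (positions B). \<Sum>i\<in>{0, 1}.
       frag_of (double_class (double_on (ins s x r (core B))
         (insert {copy i y, copy (i + \<epsilon>) x} (\<tau> ` chords B)))))"
proof -
  let ?D = "framed_add B y x \<epsilon> (ins s x r)"
  let ?a = "{y, x}"
  let ?pos = "\<lambda>i. {copy i y, copy (i + \<epsilon>) x}"
  have y: "y \<in> set (core B)" and x: "x \<notin> set (core B)"
    and C: "chords_on (set (core B) - {y}) (chords B)"
    using B unfolding framed_4T_data_def by simp_all
  have a: "?a \<notin> chords B"
    using chords_on_Union[OF C] x by blast
  have "positions ?D d = positions B d" if "d \<in> chords B" for d
  proof -
    have "framing ?D d = framing B d"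
      using that a by (auto simp: framed_add_def)
    then show ?thesis
      by (simp add: positions_def)
  qed
  then have PB: "PiE (chords B) (positions ?D) = PiE (chords B) (positions B)"
    by (rule PiE_cong)
  have Pa: "positions ?D ?a = ?pos ` {0, 1}"
    using positions_pair[of y x ?D] x y by (auto simp: framed_add_def)
  have inj: "inj_on ?pos {0, 1}"
    using x y by (auto simp: inj_on_def doubleton_eq_iff)
  have upd: "double_of ?D (\<tau>(?a := e)) = double_on (ins s x r (core B)) (insert e (\<tau> ` chords B))" for \<tau> e
  proof -
    have "(\<tau>(?a := e)) ` chords B = \<tau> ` chords B"
      using a by (intro image_cong) auto
    then show ?thesis
      by (simp only: double_of_eq framed_add_def framed_cd.simps image_insert fun_upd_same)
  qed
  have "psi_diagram ?D = (\<Sum>\<sigma>\<in>PiE (insert ?a (chords B)) (positions ?D). frag_of (double_class (double_of ?D \<sigma>)))"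
    by (simp add: psi_diagram_def framed_add_def)
  also have "\<dots> = (\<Sum>(e, \<tau>)\<in>positions ?D ?a \<times> PiE (chords B) (positions B).
      frag_of (double_class (double_of ?D (\<tau>(?a := e)))))"
    unfolding PiE_insert_eq PB[symmetric] sum.reindex[OF inj_combinator[OF a]]
    by (rule sum.cong) auto
  also have "\<dots> = (\<Sum>e\<in>positions ?D ?a. \<Sum>\<tau>\<in>PiE (chords B) (positions B).
      frag_of (double_class (double_on (ins s x r (core B)) (insert e (\<tau> ` chords B)))))"
    unfolding upd sum.cartesian_product ..
  also have "\<dots> = (\<Sum>i\<in>{0, 1}. \<Sum>\<tau>\<in>PiE (chords B) (positions B).
      frag_of (double_class (double_on (ins s x r (core B)) (insert (?pos i) (\<tau> ` chords B)))))"
    unfolding Pa sum.reindex[OF inj] o_def ..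
  also have "\<dots> = (\<Sum>\<tau>\<in>PiE (chords B) (positions B). \<Sum>i\<in>{0, 1}.
      frag_of (double_class (double_on (ins s x r (core B)) (insert (?pos i) (\<tau> ` chords B)))))"
    by (rule sum.swap)
  finally show ?thesis .
qed

text \<open>
  For \<open>k = 0\<close> this is the defining element of the relation; for \<open>k = 1\<close> the roles of the two
  sides are exchanged, as on the reversed circle, which only changes the sign.
\<close>

definition double_4T :: "double_cd \<Rightarrow> nat \<Rightarrow> nat \<Rightarrow> nat \<Rightarrow> nat \<Rightarrow> bit \<Rightarrow> double_cd set \<Rightarrow>\<^sub>0 int" where
  "double_4T B p q y x k =
     (let D = (\<lambda>s r. frag_of (double_class (double_add B y x (ins s x r)))) in
      (D k p - D (1 + k) p) - (D (1 + k) q - D k q))"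

lemma rel_4T_double_eq:
  "rel_4T_double = {double_4T B p q y x 0 | B p q y x. double_4T_data B p q y x}"
  by (simp add: rel_4T_double_def double_4T_def ins_def Let_def)

lemma double_4T_swap: "double_4T B p q y x 1 = - double_4T B p q y x 0"
  by (simp add: double_4T_def Let_def)

lemma rel_4T_double_in_M2: "rel_4T_double \<subseteq> carrier M2"
proof
  fix z assume "z \<in> rel_4T_double"
  then obtain B p q y x where B: "double_4T_data B p q y x" and z: "z = double_4T B p q y x 0"
    unfolding rel_4T_double_eq by blast
  have "\<Union>(dchords B) \<subseteq> points B" "{p, q} \<in> dchords B"
    using B chords_on_Union unfolding double_4T_data_def by blast+
  then have "p \<in> points B" "q \<in> points B"
    by auto
  then have "frag_of (double_class (double_add B y x (ins s x r))) \<in> carrier M2" if "r \<in> {p, q}" for s r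
    using that double_add_in[OF B] frag_of_double_class_in_M2 by blast
  then show "z \<in> carrier M2"
    unfolding z double_4T_def Let_def M2_def carrier_free_Abelian_group_iff
    by (meson insertCI keys_diff Un_least order_trans)
qed

lemma M2_group: "group M2"
  by (simp add: M2_def)

lemma N2_subgroup: "subgroup N2 M2"
  unfolding N2_def by (rule group.generate_is_subgroup[OF M2_group rel_4T_double_in_M2])

lemma zero_in_N2: "0 \<in> N2"
  using subgroup.one_closed[OF N2_subgroup] by (simp add: M2_def)

lemma add_in_N2: "a \<in> N2 \<Longrightarrow> b \<in> N2 \<Longrightarrow> a + b \<in> N2"
  using subgroup.m_closed[OF N2_subgroup, of a b] by (simp add: M2_def)

lemma uminus_in_N2: "a \<in> N2 \<Longrightarrow> - a \<in> N2"
  using subgroup.m_inv_closed[OF N2_subgroup, of a] subgroup.mem_carrier[OF N2_subgroup, of a]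
  by (simp add: M2_def)

lemma sum_in_N2: "(\<And>i. i \<in> I \<Longrightarrow> f i \<in> N2) \<Longrightarrow> sum f I \<in> N2"
  by (induction I rule: infinite_finite_induct) (auto simp: zero_in_N2 add_in_N2)

lemma double_4T_in_N2:
  assumes "double_4T_data B p q y x"
  shows "double_4T B p q y x k \<in> N2"
proof -
  have "double_4T B p q y x 0 \<in> N2"
    using assms unfolding N2_def rel_4T_double_eq by (blast intro: generate.incl)
  then show ?thesis
    by (cases k) (auto simp: double_4T_swap uminus_in_N2)
qed

text \<open>
  One family \<open>\<tau>\<close> and one circle \<open>i\<close> of the copy of \<open>y\<close> contribute these four terms, where
  \<open>k\<close> is the circle of the new endpoint near \<open>p\<close>.  As \<open>b\<close> has framing \<open>\<phi>\<close>, its position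
  marks \<open>p\<close> on some circle \<open>j\<close> and \<open>q\<close> on circle \<open>j + \<phi>\<close>.  So the new endpoint is next to
  a marked copy either in all four terms or in none, depending on whether \<open>k = j\<close>.
\<close>

lemma framed_4T_family_in_N2:
  assumes B: "framed_4T_data B p q y x" and \<tau>: "\<tau> \<in> PiE (chords B) (positions B)"
  defines "\<phi> \<equiv> framing B {p, q}"
    and "T \<equiv> \<lambda>i k s r. frag_of (double_class (double_on (ins s x r (core B))
        (insert {copy i y, copy k x} (\<tau> ` chords B))))"
  shows "(T i k 0 p - T i k 1 p) - (T i (k + \<phi>) (1 + \<phi>) q - T i (k + \<phi>) \<phi> q) \<in> N2"
proof -
  let ?K = "\<tau> ` chords B"
  have d: "distinct (core B)" and y: "y \<in> set (core B)" and x: "x \<notin> set (core B)"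
    and C: "chords_on (set (core B) - {y}) (chords B)" and pq: "{p, q} \<in> chords B"
    using B unfolding framed_4T_data_def by simp_all
  have pq_core: "p \<in> set (core B) - {y}" "q \<in> set (core B) - {y}"
    using chords_on_Union[OF C] pq by blast+
  have "p \<noteq> q"
    using chords_on_card[OF C pq] by auto
  have "\<tau> {p, q} \<in> positions B {p, q}"
    using PiE_mem[OF \<tau> pq] .
  then obtain j where \<tau>pq: "\<tau> {p, q} = {copy j p, copy (j + \<phi>) q}"
    unfolding positions_pair[OF \<open>p \<noteq> q\<close>] \<phi>_def by blast
  have K_core: "v \<in> set (core B) - {y}" if "copy l v \<in> \<Union>?K" for l v
    using that by (rule family_copy_in[OF C \<tau>])
  have p_marked: "copy l p \<in> \<Union>?K \<longleftrightarrow> l = j" for l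
    using copy_in_family_iff[OF C \<tau> _ pq, of p l] \<tau>pq \<open>p \<noteq> q\<close> by simp
  have q_marked: "copy l q \<in> \<Union>?K \<longleftrightarrow> l = j + \<phi>" for l
    using copy_in_family_iff[OF C \<tau> _ pq, of q l] \<tau>pq \<open>p \<noteq> q\<close> by simp
  have x_new: "copy l x \<notin> \<Union>?K" "x \<noteq> y" for l
    using K_core x y by blast+
  show ?thesis
  proof (cases "k = j")
    case False
    have unmarked: "T i l s r = T i l s' r" if "copy l r \<notin> \<Union>?K" "r \<in> set (core B) - {y}" for l s s' r
    proof -
      have "r \<noteq> y" "r \<noteq> x"
        using that(2) x by auto
      then show ?thesis
        unfolding T_def using double_on_ins_unmarked[OF that(1) _ _ x_new(2,1)] by metis
    qed
    have "T i k 0 p = T i k 1 p"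
      by (rule unmarked) (use False p_marked pq_core in auto)
    moreover have "T i (k + \<phi>) (1 + \<phi>) q = T i (k + \<phi>) \<phi> q"
      by (rule unmarked) (use False q_marked pq_core in auto)
    ultimately show ?thesis
      by (simp add: zero_in_N2)
  next
    case True
    let ?B = "double_base (core B) ?K (copy i y)"
    let ?p = "copy k p" and ?q = "copy (k + \<phi>) q" and ?y = "copy i y"
    have y_new: "?y \<notin> \<Union>?K"
      using K_core by blast
    have points: "points ?B = insert ?y (\<Union>?K)"
      unfolding double_base_def double_cd.simps
      by (rule set_double_on) (use K_core y in auto)
    have new: "copy l x \<notin> points ?B" for l
      unfolding points using x_new by simp
    have data: "double_4T_data ?B ?p ?q ?y (copy l x)" for l
      unfolding double_4T_data_def
    proof (intro conjI)
      show "distinct (core1 ?B @ core2 ?B)"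
        unfolding double_base_def double_cd.simps by (rule distinct_double_on[OF d])
      show "?y \<in> points ?B"
        unfolding points by (rule insertI1)
      have "dchords ?B = ?K"
        by (simp add: double_base_def)
      moreover have "points ?B - {?y} = \<Union>?K"
        unfolding points using y_new by blast
      ultimately show "chords_on (points ?B - {?y}) (dchords ?B)"
        using chords_on_family[OF C \<tau>] by (simp only:)
      show "{?p, ?q} \<in> dchords ?B"
        using \<tau>pq pq True \<open>dchords ?B = ?K\<close> by (metis imageI)
      show "copy l x \<notin> points ?B"
        by (rule new)
    qed
    have Tp: "T i k s p = frag_of (double_class (double_add ?B ?y (copy k x) (ins (s + k) (copy k x) ?p)))" for s
      unfolding T_def using p_marked True x x_new by (subst double_on_ins_marked) auto
    \<comment> \<open>Here the new endpoint is named \<open>copy (k + \<phi>) x\<close>; it gets the name used at \<open>p\<close>.\<close>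
    have Tq: "T i (k + \<phi>) s q = frag_of (double_class (double_add ?B ?y (copy k x) (ins (s + (k + \<phi>)) (copy k x) ?q)))" for s
    proof -
      have "T i (k + \<phi>) s q = frag_of (double_class (double_add ?B ?y (copy (k + \<phi>) x)
          (ins (s + (k + \<phi>)) (copy (k + \<phi>) x) ?q)))"
        unfolding T_def using q_marked True x x_new by (subst double_on_ins_marked) auto
      also have "\<dots> = frag_of (double_class (double_add ?B ?y (copy k x) (ins (s + (k + \<phi>)) (copy k x) ?q)))"
      proof -
        have "?q \<in> points ?B"
          unfolding points using q_marked True by blast
        then show ?thesis
          by (intro arg_cong[where f = frag_of] double_class_add_rename[OF data new])
      qed
      finally show ?thesis .
    qed
    \<comment> \<open>The framing enters the side of \<open>q\<close> twice, through the framed relation and through the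
      circle of the copy of \<open>q\<close>, and cancels.\<close>
    have bits: "1 + \<phi> + (k + \<phi>) = 1 + k" "\<phi> + (k + \<phi>) = k"
      by (cases \<phi>; cases k; simp)+
    have "(T i k 0 p - T i k 1 p) - (T i (k + \<phi>) (1 + \<phi>) q - T i (k + \<phi>) \<phi> q) =
        double_4T ?B ?p ?q ?y (copy k x) k"
      unfolding Tp Tq bits double_4T_def Let_def by simp
    then show ?thesis
      using double_4T_in_N2[OF data] by simp
  qed
qed

text \<open>
  Both kinds of framed relations at once: framing 1 of \<open>b\<close> exchanges the sides at \<open>q\<close> and
  changes the framing of the new chord there.
\<close>

definition framed_4T :: "framed_cd \<Rightarrow> nat \<Rightarrow> nat \<Rightarrow> nat \<Rightarrow> nat \<Rightarrow> bit \<Rightarrow> framed_cd set \<Rightarrow>\<^sub>0 int" where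
  "framed_4T B p q y x \<epsilon> =
     (let \<phi> = framing B {p, q};
          D = (\<lambda>\<epsilon> s r. frag_of (framed_class (framed_add B y x \<epsilon> (ins s x r)))) in
      (D \<epsilon> 0 p - D \<epsilon> 1 p) - (D (\<epsilon> + \<phi>) (1 + \<phi>) q - D (\<epsilon> + \<phi>) \<phi> q))"

lemma rel_4T_framed_subset:
  "rel_4T_framed \<subseteq> {framed_4T B p q y x \<epsilon> | B p q y x \<epsilon>. framed_4T_data B p q y x}"
proof
  let ?D = "\<lambda>B y x \<epsilon> i. frag_of (framed_class (framed_add B y x \<epsilon> i))"
  fix z assume "z \<in> rel_4T_framed"
  then consider
      (0) B p q y x \<epsilon> where "framed_4T_data B p q y x" "framing B {p, q} = 0"
        "z = (?D B y x \<epsilon> (ins_before x p) - ?D B y x \<epsilon> (ins_after x p))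
          - (?D B y x \<epsilon> (ins_after x q) - ?D B y x \<epsilon> (ins_before x q))"
    | (1) B p q y x \<epsilon> where "framed_4T_data B p q y x" "framing B {p, q} = 1"
        "z = (?D B y x \<epsilon> (ins_before x p) - ?D B y x \<epsilon> (ins_after x p))
          - (?D B y x (1 - \<epsilon>) (ins_before x q) - ?D B y x (1 - \<epsilon>) (ins_after x q))"
    unfolding rel_4T_framed_def Let_def Un_iff mem_Collect_eq by (elim disjE exE conjE)
  then show "z \<in> {framed_4T B p q y x \<epsilon> | B p q y x \<epsilon>. framed_4T_data B p q y x}"
  proof cases
    case 0
    then have "z = framed_4T B p q y x \<epsilon>"
      by (simp add: framed_4T_def ins_def)
    then show ?thesis
      using 0(1) by blast
  next
    case 1
    then have "z = framed_4T B p q y x \<epsilon>"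
      by (simp add: framed_4T_def ins_def add.commute)
    then show ?thesis
      using 1(1) by blast
  qed
qed

lemma rel_4T_framed_in_Mf: "rel_4T_framed \<subseteq> carrier Mf"
proof
  fix z assume "z \<in> rel_4T_framed"
  then obtain B p q y x \<epsilon> where B: "framed_4T_data B p q y x" and z: "z = framed_4T B p q y x \<epsilon>"
    using rel_4T_framed_subset by blast
  have "frag_of (framed_class (framed_add B y x \<delta> (ins s x r))) \<in> carrier Mf" if "r \<in> {p, q}" for \<delta> s r
    using framed_add_in[OF B that, of \<delta> s] by (simp add: Mf_def framed_class_def quotientI)
  then show "z \<in> carrier Mf"
    unfolding z framed_4T_def Let_def Mf_def carrier_free_Abelian_group_iff
    by (meson insertCI keys_diff Un_least order_trans)
qed

lemma psi_diff: "psi (a - b) = psi a - psi b"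
  by (simp add: psi_def frag_extend_diff)

lemma psi_framed_4T:
  assumes B: "framed_4T_data B p q y x"
  shows "psi (framed_4T B p q y x \<epsilon>) \<in> N2"
proof -
  define \<phi> where "\<phi> = framing B {p, q}"
  define T where "T \<tau> i k s r = frag_of (double_class (double_on (ins s x r (core B))
        (insert {copy i y, copy k x} (\<tau> ` chords B))))" for \<tau> i k s r
  let ?F = "PiE (chords B) (positions B)"
  have psi: "psi (frag_of (framed_class (framed_add B y x \<delta> (ins s x r)))) =
      (\<Sum>\<tau>\<in>?F. \<Sum>i\<in>{0, 1}. T \<tau> i (i + \<delta>) s r)" if "r \<in> {p, q}" for \<delta> s r
    unfolding T_def psi_frag_of[OF framed_add_in[OF B that]] by (rule psi_diagram_framed_add[OF B])
  have "psi (framed_4T B p q y x \<epsilon>) =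
      (\<Sum>\<tau>\<in>?F. \<Sum>i\<in>{0, 1}. (T \<tau> i (i + \<epsilon>) 0 p - T \<tau> i (i + \<epsilon>) 1 p) -
        (T \<tau> i (i + (\<epsilon> + \<phi>)) (1 + \<phi>) q - T \<tau> i (i + (\<epsilon> + \<phi>)) \<phi> q))"
    unfolding framed_4T_def Let_def psi_diff \<phi>_def[symmetric] psi[OF insertI1] psi[OF insertI2[OF singletonI]]
    by (simp only: sum_subtractf)
  also have "\<dots> \<in> N2"
  proof (intro sum_in_N2)
    fix \<tau> i assume "\<tau> \<in> ?F"
    then show "(T \<tau> i (i + \<epsilon>) 0 p - T \<tau> i (i + \<epsilon>) 1 p) -
        (T \<tau> i (i + (\<epsilon> + \<phi>)) (1 + \<phi>) q - T \<tau> i (i + (\<epsilon> + \<phi>)) \<phi> q) \<in> N2"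
      using framed_4T_family_in_N2[OF B, of \<tau> i "i + \<epsilon>"] unfolding T_def \<phi>_def add.assoc by simp
  qed
  finally show ?thesis .
qed

theorem theorem4p1:
  shows "psi \<in> hom Mf M2 \<and>
    (\<forall>D\<in>framed_cds. psi (frag_of (framed_class D)) = psi_diagram D) \<and>
    (\<exists>\<Psi> \<in> hom (Mf Mod Nf) (M2 Mod N2).
       \<forall>c\<in>carrier Mf. \<Psi> (Nf #>\<^bsub>Mf\<^esub> c) = N2 #>\<^bsub>M2\<^esub> psi c)"
proof (intro conjI ballI)
  show "psi \<in> hom Mf M2"
    by (rule psi_hom)
  show "psi (frag_of (framed_class D)) = psi_diagram D" if "D \<in> framed_cds" for D
    using that by (rule psi_frag_of)
  have Mf: "comm_group Mf" and M2: "comm_group M2"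
    by (simp_all add: Mf_def M2_def abelian_free_Abelian_group)
  then have groups: "group Mf" "group M2"
    by (simp_all add: comm_group_def)
  interpret psi: group_hom Mf M2 psi
    using groups psi_hom by (simp add: group_hom_def group_hom_axioms_def)
  have "subgroup Nf Mf"
    unfolding Nf_def by (rule group.generate_is_subgroup[OF groups(1) rel_4T_framed_in_Mf])
  then have Nf: "Nf \<lhd> Mf"
    by (rule comm_group.subgroup_imp_normal[OF Mf])
  have N2: "N2 \<lhd> M2"
    using N2_subgroup by (rule comm_group.subgroup_imp_normal[OF M2])
  have "psi ` rel_4T_framed \<subseteq> N2"
    using rel_4T_framed_subset psi_framed_4T by blast
  then have "psi ` Nf \<subseteq> N2"
    unfolding Nf_def psi.generate_img[OF rel_4T_framed_in_Mf, symmetric]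
    using N2_subgroup by (rule group.generate_subgroup_incl[OF groups(2)])
  define h where "h = (\<lambda>c. N2 #>\<^bsub>M2\<^esub> psi c)"
  have h: "h \<in> hom Mf (M2 Mod N2)"
    using hom_compose[OF psi_hom normal.r_coset_hom_Mod[OF N2]] by (simp add: h_def comp_def)
  interpret h: group_hom Mf "M2 Mod N2" h
    using groups h normal.factorgroup_is_group[OF N2] by (simp add: group_hom_def group_hom_axioms_def)
  have "Nf \<subseteq> kernel Mf (M2 Mod N2) h"
  proof
    fix c assume c: "c \<in> Nf"
    then have "psi c \<in> N2"
      using \<open>psi ` Nf \<subseteq> N2\<close> by blast
    then have "h c = N2"
      unfolding h_def
      using group.coset_join2[OF groups(2) subgroup.mem_carrier[OF N2_subgroup] N2_subgroup] by blast
    then show "c \<in> kernel Mf (M2 Mod N2) h"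
      using subgroup.mem_carrier[OF \<open>subgroup Nf Mf\<close> c] by (simp add: kernel_def)
  qed
  then obtain \<Psi> where "\<Psi> \<in> hom (Mf Mod Nf) (M2 Mod N2)"
    "\<And>c. c \<in> carrier Mf \<Longrightarrow> \<Psi> (Nf #>\<^bsub>Mf\<^esub> c) = h c"
    using h.FactGroup_universal_kernel[OF Nf] by blast
  then show "\<exists>\<Psi>\<in>hom (Mf Mod Nf) (M2 Mod N2). \<forall>c\<in>carrier Mf. \<Psi> (Nf #>\<^bsub>Mf\<^esub> c) = N2 #>\<^bsub>M2\<^esub> psi c"
    unfolding h_def by blast
qed

end
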